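(* Let $\mathbb{K}$ be Pol's compactum and let $\mathbb{I}=[0,1]$. For each integer $n\ge 0$, $\dim_G(\mathbb{K}\times\mathbb{I}^n)\le\omega+n+1$.
   Context: Pol's compactum: a compact metrizable space $\mathbb{K}=M\cup L$, where $M$ is a completely metrizable, separable, totally disconnected, hereditarily strongly infinite dimensional space which is dense in $\mathbb{K}$, and the remainder $L=\mathbb{K}\setminus M$ is a union $L=\bigcup_{k=1}^{\infty}L_k$ of compact finite dimensional sets with $L_k\subset L_m$ and $\dim(L_k)<\dim(L_m)$ for $k<m$. A space is strongly infinite dimensional if it is not weakly infinite dimensional, where $X$ is weakly infinite dimensional if for each sequence $(\mathcal{U}_k)_{k\in\mathbb{N}}$ of two-element open covers of $X$ there are pairwise disjoint families $\mathcal{V}_k$ of sets refining $\mathcal{U}_k$ such that $\bigcup_k\mathcal{V}_k$ is an open cover of $X$. "Hereditarily strongly infinite dimensional" means that $M$ is strongly infinite dimensional and each subspace of $M$ is either at most zero-dimensional or strongly infinite dimensional. Game dimension: for an ordinal $\alpha$, the game ${\sf G}_c^{\alpha}(\mathcal{O},\mathcal{O})$ on a separable metric space $X$ has one inning per $\gamma<\alpha$: in inning $\gamma$ player ONE chooses an open cover $A_\gamma$ of $X$ and TWO responds with a pairwise disjoint family $B_\gamma$ of sets refining $A_\gamma$ (each member of $B_\gamma$ is contained in a member of $A_\gamma$). TWO wins the play if $\bigcup_{\gamma<\alpha}B_\gamma$ is an open cover of $X$; otherwise ONE wins. ${\sf tp}_{{\sf S}_c(\mathcal{O},\mathcal{O})}(X)$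 is the least ordinal $\alpha$ such that TWO has a winning strategy in this game on $X$, and $\dim_G(X)$ is defined by $1+\dim_G(X)={\sf tp}_{{\sf S}_c(\mathcal{O},\mathcal{O})}(X)$. *)

theory Defs
  imports "HOL-Analysis.Analysis" "HOL-Library.Disjoint_Sets" "HOL-Library.FuncSet"
begin

unbundle cardinal_syntax

section \<open>Covers and dimension\<close>

definition open_cover :: "'a topology \<Rightarrow> 'a set set \<Rightarrow> bool"
  where "open_cover X \<U> \<longleftrightarrow> (\<forall>U\<in>\<U>. openin X U) \<and> \<Union>\<U> = topspace X"

text \<open>The refining family is not required to be a cover, nor to consist of open sets.\<close>

definition disjoint_refinement :: "'a set set \<Rightarrow> 'a set set \<Rightarrow> bool"
  where "disjoint_refinement \<V> \<U> \<longleftrightarrow> disjoint \<V> \<and> (\<forall>V\<in>\<V>. \<exists>U\<in>\<U>. V \<subseteq> U)"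

definition weakly_infinite_dimensional :: "'a topology \<Rightarrow> bool"
  where "weakly_infinite_dimensional X \<longleftrightarrow>
    (\<forall>\<U> :: nat \<Rightarrow> 'a set set. (\<forall>k. open_cover X (\<U> k) \<and> card (\<U> k) = 2) \<longrightarrow>
      (\<exists>\<V>. (\<forall>k. disjoint_refinement (\<V> k) (\<U> k)) \<and> open_cover X (\<Union>k. \<V> k)))"

abbreviation strongly_infinite_dimensional :: "'a topology \<Rightarrow> bool"
  where "strongly_infinite_dimensional X \<equiv> \<not> weakly_infinite_dimensional X"

definition totally_disconnected :: "'a topology \<Rightarrow> bool"
  where "totally_disconnected X \<longleftrightarrow> (\<forall>C. connectedin X C \<longrightarrow> (\<exists>a. C \<subseteq> {a}))"

text \<open>The number attached to the library's inductive predicate \<^const>\<open>dimension_le\<close>;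
  it is \<open>-1\<close> for the empty space and \<open>\<infinity>\<close> if no bound exists. For separable metrizable
  spaces, the only ones to which it is applied, all the usual dimension functions agree.\<close>

definition top_dim :: "'a topology \<Rightarrow> ereal"
  where "top_dim X = Inf {ereal (of_int n) |n. X dim_le n}"

lemma top_dim_le_iff: "top_dim X \<le> ereal (of_int n) \<longleftrightarrow> X dim_le n"
proof
  assume le: "top_dim X \<le> ereal (of_int n)"
  have "top_dim X < ereal (of_int n + 1)"
    by (rule le_less_trans[OF le]) simp
  then obtain m where m: "X dim_le m" "ereal (of_int m) < ereal (of_int n + 1)"
    unfolding top_dim_def Inf_less_iff by blast
  then have "m \<le> n"
    by simp
  with m(1) show "X dim_le n"
    using dimension_le_mono by blast
next
  assume "X dim_le n"
  then show "top_dim X \<le> ereal (of_int n)"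
    unfolding top_dim_def by (intro Inf_lower) blast
qed

lemma top_dim_finite_iff: "top_dim X < \<infinity> \<longleftrightarrow> (\<exists>n. X dim_le n)"
  unfolding top_dim_def Inf_less_iff by fastforce

definition pol_compactum :: "'a topology \<Rightarrow> bool"
  where "pol_compactum K \<longleftrightarrow> compact_space K \<and> metrizable_space K \<and>
    (\<exists>M L. M \<subseteq> topspace K \<and>
       completely_metrizable_space (subtopology K M) \<and>
       separable_space (subtopology K M) \<and>
       totally_disconnected (subtopology K M) \<and>
       strongly_infinite_dimensional (subtopology K M) \<and>
       (\<forall>S \<subseteq> M. top_dim (subtopology K S) \<le> 0 \<or>
                strongly_infinite_dimensional (subtopology K S)) \<and>
       K closure_of M = topspace K \<and>
       topspace K - M = (\<Union>k\<in>{1::nat..}. L k) \<and>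
       (\<forall>k\<ge>1. compactin K (L k) \<and> top_dim (subtopology K (L k)) < \<infinity>) \<and>
       (\<forall>k\<ge>1. \<forall>m>k. L k \<subseteq> L m \<and>
          top_dim (subtopology K (L k)) < top_dim (subtopology K (L m))))"


section \<open>The game and its dimension\<close>

text \<open>Ordinals are represented by well-order relations, compared by \<^const>\<open>ordLeq\<close>: the
  ordinal \<open>\<omega>\<close> is \<^const>\<open>natLeq\<close>, a finite ordinal \<open>n\<close> is \<open>natLeq_on n\<close>. In the ordinal
  sum the second summand is placed above the first.\<close>

definition ord_plus :: "'i rel \<Rightarrow> 'j rel \<Rightarrow> ('i + 'j) rel"  (infixl \<open>+\<^sub>o\<close> 65)
  where "r +\<^sub>o s = map_prod Inl Inl ` r \<union> map_prod Inr Inr ` s \<union>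
    {(Inl x, Inr y) |x y. x \<in> Field r \<and> y \<in> Field s}"

text \<open>The innings of the game of length \<open>r\<close> are the elements of the field of \<open>r\<close>;
  \<open>A\<close> and \<open>B\<close> are the sequences of moves of ONE and TWO.\<close>

definition two_wins_play ::
    "'a topology \<Rightarrow> 'i rel \<Rightarrow> ('i \<Rightarrow> 'a set set) \<Rightarrow> ('i \<Rightarrow> 'a set set) \<Rightarrow> bool"
  where "two_wins_play X r A B \<longleftrightarrow>
    (\<forall>\<gamma>\<in>Field r. disjoint_refinement (B \<gamma>) (A \<gamma>)) \<and> open_cover X (\<Union>\<gamma>\<in>Field r. B \<gamma>)"

text \<open>A strategy \<open>\<sigma>\<close> of TWO answers in inning \<open>\<gamma>\<close> with knowledge of the moves of ONE in the
  innings up to and including \<open>\<gamma>\<close>.\<close>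

definition two_has_winning_strategy :: "'a topology \<Rightarrow> 'i rel \<Rightarrow> bool"
  where "two_has_winning_strategy X r \<longleftrightarrow>
    (\<exists>\<sigma> :: 'i \<Rightarrow> ('i \<Rightarrow> 'a set set) \<Rightarrow> 'a set set.
      \<forall>A. (\<forall>\<gamma>\<in>Field r. open_cover X (A \<gamma>)) \<longrightarrow>
          two_wins_play X r A (\<lambda>\<gamma>. \<sigma> \<gamma> (restrict A (under r \<gamma>))))"

text \<open>It suffices to compare \<open>r\<close> with well-orders on the same type, since every smaller ordinal is
  represented by an initial segment of \<open>r\<close>. Likewise \<open>d\<close> below is determined up to
  order isomorphism, because ordinal addition is left cancellative.\<close>

definition has_game_type :: "'a topology \<Rightarrow> 'i rel \<Rightarrow> bool"
  where "has_game_type X r \<longleftrightarrow> Well_order r \<and> two_has_winning_strategy X r \<and>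
    (\<forall>s :: 'i rel. Well_order s \<and> two_has_winning_strategy X s \<longrightarrow> r \<le>o s)"

definition has_game_dim :: "'a topology \<Rightarrow> 'i rel \<Rightarrow> bool"
  where "has_game_dim X d \<longleftrightarrow> Well_order d \<and> has_game_type X (natLeq_on 1 +\<^sub>o d)"

text \<open>An ordinal that is at most \<open>r\<close> has a representative on the type of \<open>r\<close>.\<close>

definition game_dim_le :: "'a topology \<Rightarrow> 'i rel \<Rightarrow> bool"
  where "game_dim_le X r \<longleftrightarrow> (\<exists>d :: 'i rel. has_game_dim X d \<and> d \<le>o r)"

definition unit_cube :: "nat \<Rightarrow> (nat \<Rightarrow> real) topology"
  where "unit_cube n = product_topology (\<lambda>_. top_of_set {0..1}) {..<n}"

end

theory Submission
  imports Defs
begin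

text \<open>
  A zero-dimensional subset of a separable metrizable space can be covered in a single inning,
  whatever cover ONE plays. Each \<open>L k\<close> is a countable union of zero-dimensional sets, and the cube
  \<open>[0,1]\<^sup>n\<close> is the union of \<open>n + 1\<close> zero-dimensional sets \<open>D 0, \<dots>, D n\<close>; so TWO can cover
  \<open>L \<times> [0,1]\<^sup>n\<close> in the first \<open>\<omega>\<close> innings. What is left is compact and its projection \<open>Z\<close> to
  the compactum is a compact subset of the totally disconnected set \<open>M\<close>, hence zero-dimensional.
  The sets \<open>Z \<times> D i\<close> are then covered in the last \<open>n + 1\<close> innings. This gives a win in \<open>\<omega> + n + 1\<close>
  innings. The least winning length is nonzero and so has the form \<open>1 + d\<close>, and \<open>d\<close> does not exceed it.
\<close>

section \<open>Zero-dimensional sets\<close>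

text \<open>Total boundedness supplies a finite net at each scale \<open>inverse (Suc n)\<close>;
  the balls of that radius around the net points, over all \<open>n\<close>, form a countable
  base.\<close>

lemma compact_metrizable_second_countable:
  assumes "compact_space X" "metrizable_space X"
  shows "second_countable X"
proof -
  obtain M d where "Metric_space M d" and X: "X = Metric_space.mtopology M d"
    using assms(2) unfolding metrizable_space_def by blast
  then interpret Metric_space M d by simp
  have "mtotally_bounded M"
    using assms(1) X compactin_imp_mtotally_bounded
    by (metis compact_space_def topspace_mtopology)
  then have "\<exists>C. finite C \<and> C \<subseteq> M \<and> M \<subseteq> (\<Union>x\<in>C. mball x (inverse (Suc n)))" for n
    unfolding mtotally_bounded_def by simp
  then obtain C where C: "\<And>n. finite (C n)" "\<And>n. C n \<subseteq> M"
      "\<And>n. M \<subseteq> (\<Union>x\<in>C n. mball x (inverse (Suc n)))"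
    by metis
  let ?B = "\<Union>n. (\<lambda>x. mball x (inverse (Suc n))) ` C n"
  have "\<exists>V\<in>?B. x \<in> V \<and> V \<subseteq> U" if U: "openin X U \<and> x \<in> U" for U x
  proof -
    obtain r where r: "r > 0" "mball x r \<subseteq> U" and xM: "x \<in> M"
      using U unfolding X openin_mtopology by blast
    \<comment> \<open>A ball of radius below \<open>r/2\<close> that contains \<open>x\<close> stays
      inside the ball of radius \<open>r\<close> around \<open>x\<close>.\<close>
    obtain n where n: "inverse (Suc n) < r/2"
      using reals_Archimedean[of "r/2"] r(1) by auto
    obtain c where c: "c \<in> C n" "x \<in> mball c (inverse (Suc n))"
      using C(3)[of n] xM by blast
    have "mball c (inverse (Suc n)) \<subseteq> mball x r"
    proof
      fix y assume y: "y \<in> mball c (inverse (Suc n))"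
      have "d x y \<le> d c x + d c y"
        using c y triangle[of x c y] by (auto simp: commute)
      then show "y \<in> mball x r"
        using c y n by auto
    qed
    then show ?thesis
      using c r by blast
  qed
  moreover have "countable ?B"
    using C(1) by (intro countable_UN) (auto simp: countable_finite)
  moreover have "\<forall>V\<in>?B. openin X V"
    by (auto simp: X)
  ultimately show ?thesis
    unfolding second_countable_def by (intro exI[of _ ?B] conjI allI impI)
qed

lemma dim_le_0_iff_clopen_base:
  "X dim_le 0 \<longleftrightarrow>
    (\<forall>W x. openin X W \<and> x \<in> W \<longrightarrow> (\<exists>U. (closedin X U \<and> openin X U) \<and> x \<in> U \<and> U \<subseteq> W))"
  unfolding dimension_le_0_neighbourhood_base_of_clopen
  by (rule open_neighbourhood_base_of) blast

lemma dim_le_0E: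
  assumes "X dim_le 0" "openin X W" "x \<in> W"
  obtains U where "closedin X U" "openin X U" "x \<in> U" "U \<subseteq> W"
  using assms unfolding dim_le_0_iff_clopen_base by metis

text \<open>In a compact Hausdorff space a component can be separated by a clopen set from any
  closed set disjoint from it. Here the components are singletons, so such clopen sets form a
  base.\<close>

lemma compact_totally_disconnected_dim_le_0:
  assumes "compact_space X" "Hausdorff_space X" "totally_disconnected X"
  shows "X dim_le 0"
  unfolding dim_le_0_iff_clopen_base
proof clarify
  fix W x assume W: "openin X W" "x \<in> W"
  then have x: "x \<in> topspace X"
    using openin_subset by blast
  have "connectedin X (connected_component_of_set X x)"
    by (simp add: connectedin_connected_component_of)
  then obtain a where "connected_component_of_set X x \<subseteq> {a}"
    using assms(3) unfolding totally_disconnected_def by blast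
  moreover have "x \<in> connected_component_of_set X x"
    using x by (simp add: connected_component_of_refl)
  ultimately have eq: "connected_component_of_set X x = {x}"
    by blast
  have "separated_between X {x} (topspace X - W)"
  proof (rule separated_between_compact_connected_component)
    show "locally_compact_space X"
      by (simp add: assms(1) compact_imp_locally_compact_space)
    show "{x} \<in> connected_components_of X"
      using x eq unfolding connected_components_of_def by blast
    show "compactin X {x}"
      using x by simp
    show "closedin X (topspace X - W)"
      using W(1) by blast
  qed (use W assms(2) in auto)
  then obtain U where U: "closedin X U" "openin X U" "{x} \<subseteq> U" "topspace X - W \<subseteq> topspace X - U"
    unfolding separated_between by blast
  moreover have "U \<subseteq> W"
    using U(4) openin_subset[OF U(2)] by blast
  ultimately show "\<exists>U. (closedin X U \<and> openin X U) \<and> x \<in> U \<and> U \<subseteq> W"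
    by blast
qed

section \<open>Covering a zero-dimensional set in one inning\<close>

text \<open>This is the answer of TWO in a single inning. By the Lindelof property \<open>S\<close>
  splits into countably many disjoint relatively open pieces, each inside a member of the cover. The
  pieces are then enlarged to sets open in the whole space, using a metric to keep them
  disjoint.\<close>

lemma disjoint_open_refinement_of_zero_dimensional_subset:
  assumes X: "metrizable_space X" "second_countable X" "open_cover X \<A>"
    and S: "subtopology X S dim_le 0"
  shows "\<exists>\<B>. disjoint_refinement \<B> \<A> \<and> (\<forall>B\<in>\<B>. openin X B) \<and> S \<inter> topspace X \<subseteq> \<Union>\<B>"
proof (cases "S \<inter> topspace X = {}")
  case True
  then show ?thesis
    by (intro exI[of _ "{}"]) (auto simp: disjoint_refinement_def)
next
  case False
  let ?Y = "subtopology X S"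
  obtain M d where "Metric_space M d" and XM: "X = Metric_space.mtopology M d"
    using X(1) unfolding metrizable_space_def by blast
  then interpret Metric_space M d by simp
  define \<C> where "\<C> = {C. closedin ?Y C \<and> openin ?Y C \<and> (\<exists>A\<in>\<A>. C \<subseteq> A)}"
  have "topspace ?Y \<subseteq> \<Union>\<C>"
  proof
    fix x assume x: "x \<in> topspace ?Y"
    then obtain A where A: "A \<in> \<A>" "x \<in> A"
      using X(3) unfolding open_cover_def by auto
    have "openin ?Y (S \<inter> A)"
      using A X(3) unfolding open_cover_def by (meson openin_subtopology_Int2)
    moreover have "x \<in> S \<inter> A"
      using A x by simp
    ultimately obtain U where "closedin ?Y U" "openin ?Y U" "x \<in> U" "U \<subseteq> S \<inter> A"
      by (rule dim_le_0E[OF S])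
    then show "x \<in> \<Union>\<C>"
      using A unfolding \<C>_def by blast
  qed
  moreover have C_open: "\<forall>C\<in>\<C>. openin ?Y C"
    unfolding \<C>_def by blast
  moreover have "Lindelof_space ?Y"
    by (simp add: X(2) second_countable_imp_Lindelof_space second_countable_subtopology)
  ultimately obtain \<V> where V: "countable \<V>" "\<V> \<subseteq> \<C>" "topspace ?Y \<subseteq> \<Union>\<V>"
    unfolding Lindelof_space_alt using C_open by (meson subset_iff)
  then have "\<V> \<noteq> {}"
    using False by auto
  then obtain C :: "nat \<Rightarrow> 'a set" where C: "range C = \<V>"
    using V(1) uncountable_def by metis
  define E where "E = disjointed C"
  have clopen: "closedin ?Y (C k)" "openin ?Y (C k)" for k
    using C V(2) unfolding \<C>_def by auto
  \<comment> \<open>Only the finitely many earlier sets are subtracted from \<open>C k\<close>, and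
    these are closed in the subspace, so the difference stays open.\<close>
  have E_open: "openin ?Y (E k)" for k
    unfolding E_def disjointed_def
    using clopen by (intro openin_diff closedin_Union) auto
  have E_disj: "disjoint_family E"
    unfolding E_def by (rule disjoint_family_disjointed)
  have E_cover: "S \<inter> topspace X \<subseteq> (\<Union>k. E k)"
    using V(3) C unfolding E_def UN_disjointed_eq by (auto simp: Int_commute)
  have "\<exists>A\<in>\<A>. E k \<subseteq> A" for k
  proof -
    have "C k \<in> \<C>"
      using C V(2) by blast
    then show ?thesis
      using disjointed_subset[of C k] unfolding E_def \<C>_def by blast
  qed
  then obtain A where A: "\<And>k. A k \<in> \<A>" "\<And>k. E k \<subseteq> A k"
    by metis
  have "\<exists>r>0. mball x r \<inter> S \<subseteq> E k" if "x \<in> E k" for k x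
  proof -
    obtain W where W: "openin X W" "E k = W \<inter> S"
      using E_open[of k] unfolding openin_subtopology by blast
    then obtain r where "r > 0" "mball x r \<subseteq> W"
      using \<open>x \<in> E k\<close> unfolding XM openin_mtopology by blast
    then show ?thesis
      using W by blast
  qed
  then have "\<exists>r. \<forall>k x. x \<in> E k \<longrightarrow> r k x > 0 \<and> mball x (r k x) \<inter> S \<subseteq> E k"
    by (intro choice allI) blast
  then obtain r where r: "\<And>k x. x \<in> E k \<Longrightarrow> r k x > 0" "\<And>k x. x \<in> E k \<Longrightarrow> mball x (r k x) \<inter> S \<subseteq> E k"
    by auto
  \<comment> \<open>Halving the radii makes the enlarged sets disjoint: of two centres at distance less than the
    sum of the half radii, one lies in the full ball around the other.\<close>
  define G where "G k = A k \<inter> (\<Union>x\<in>E k. mball x (r k x / 2))" for k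
  have E_sub: "E k \<subseteq> S \<inter> M" for k
    using openin_subset[OF E_open[of k]] by (auto simp: XM)
  have G_open: "openin X (G k)" for k
  proof -
    have "openin X (\<Union>x\<in>E k. mball x (r k x / 2))"
      by (auto simp: XM)
    moreover have "openin X (A k)"
      using A(1) X(3) unfolding open_cover_def by blast
    ultimately show ?thesis
      unfolding G_def by (intro openin_Int)
  qed
  have E_G: "E k \<subseteq> G k" for k
  proof
    fix x assume x: "x \<in> E k"
    then have "x \<in> mball x (r k x / 2)"
      using r(1)[OF x] E_sub[of k] by auto
    then show "x \<in> G k"
      using x A(2)[of k] unfolding G_def by blast
  qed
  have G_disj: "G j \<inter> G k = {}" if "j \<noteq> k" for j k
  proof (rule ccontr)
    assume "G j \<inter> G k \<noteq> {}"
    then obtain y u v where u: "u \<in> E j" "y \<in> mball u (r j u / 2)" and v: "v \<in> E k" "y \<in> mball v (r k v / 2)"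
      unfolding G_def by blast
    have le: "d u v < r j u / 2 + r k v / 2"
      using u v triangle[of u y v] commute[of v y] by auto
    have "v \<in> E j \<or> u \<in> E k"
    proof (cases "r j u \<le> r k v")
      case True
      then have "u \<in> mball v (r k v) \<inter> S"
        using u v le E_sub by (auto simp: commute)
      then show ?thesis
        using r(2) v(1) by blast
    next
      case False
      then have "v \<in> mball u (r j u) \<inter> S"
        using u v le E_sub by auto
      then show ?thesis
        using r(2) u(1) by blast
    qed
    then show False
      using E_disj u v that unfolding disjoint_family_on_def by blast
  qed
  show ?thesis
  proof (intro exI conjI)
    show "disjoint_refinement (range G) \<A>"
    proof -
      have "G k \<subseteq> A k" for k
        unfolding G_def by blast
      moreover have "disjoint (range G)"
        unfolding disjoint_def using G_disj by (metis imageE)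
      ultimately show ?thesis
        unfolding disjoint_refinement_def using A(1) by blast
    qed
    show "\<forall>B\<in>range G. openin X B"
      using G_open by blast
    show "S \<inter> topspace X \<subseteq> \<Union>(range G)"
      using E_cover E_G by blast
  qed
qed

section \<open>Decomposition into zero-dimensional sets\<close>

text \<open>Induction on the dimension, applied to the frontiers of a countable base. Countably many
  pieces suffice because \<omega> innings are available for them, and this form of the decomposition
  does not go through the sum theorem.\<close>

lemma dim_le_imp_countable_Union_zero_dimensional:
  assumes "X dim_le n" "second_countable X"
  shows "\<exists>F :: nat \<Rightarrow> 'a set. (\<forall>j. subtopology X (F j) dim_le 0) \<and> topspace X \<subseteq> (\<Union>j. F j)"
  using assms
proof (induction rule: dimension_le.induct)
  case (1 n X)
  let ?Z = "\<lambda>Y. \<exists>F :: nat \<Rightarrow> 'a set.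
    (\<forall>j. subtopology Y (F j) dim_le 0) \<and> topspace Y \<subseteq> (\<Union>j. F j)"
  obtain \<B> where \<B>: "countable \<B>" "\<And>V. V \<in> \<B> \<Longrightarrow> openin X V"
    "\<And>U x. openin X U \<Longrightarrow> x \<in> U \<Longrightarrow> \<exists>V\<in>\<B>. x \<in> V \<and> V \<subseteq> U"
    using 1(3) unfolding second_countable_def by metis
  \<comment> \<open>Choosing one \<open>U\<close> for each pair of basic sets \<open>A \<subseteq> B\<close> extracts a countable base of sets
    whose frontiers have smaller dimension; the complement of these frontiers is zero-dimensional.\<close>
  define P where "P A U B \<longleftrightarrow> openin X U \<and> A \<subseteq> U \<and> U \<subseteq> B \<and>
     ?Z (subtopology X (X frontier_of U))" for A U B
  define I where "I = {(A, B). A \<in> \<B> \<and> B \<in> \<B> \<and> (\<exists>U. P A U B)}"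
  define u where "u = (\<lambda>(A, B). SOME U. P A U B)"
  have Pu: "P (fst i) (u i) (snd i)" if "i \<in> I" for i
    using that unfolding I_def u_def by (auto intro: someI)
  have "countable I"
    by (rule countable_subset[of _ "\<B> \<times> \<B>"]) (auto simp: I_def \<B>(1))
  have base: "\<exists>i\<in>I. x \<in> u i \<and> u i \<subseteq> V" if V: "openin X V" "x \<in> V" for x V
  proof -
    obtain B where B: "B \<in> \<B>" "x \<in> B" "B \<subseteq> V"
      using \<B>(3) V by blast
    then obtain U where U: "x \<in> U" "U \<subseteq> B" "openin X U"
        "second_countable (subtopology X (X frontier_of U)) \<longrightarrow>
          ?Z (subtopology X (X frontier_of U))"
      using 1(2)[OF \<B>(2)[OF B(1)] B(2)] by blast
    obtain A where A: "A \<in> \<B>" "x \<in> A" "A \<subseteq> U"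
      using \<B>(3) U by blast
    have "P A U B"
      using U A 1(3) unfolding P_def by (auto simp: second_countable_subtopology)
    then have "(A, B) \<in> I"
      using A B unfolding I_def by blast
    then show ?thesis
      using Pu[of "(A,B)"] A B unfolding P_def by (intro bexI[of _ "(A, B)"]) auto
  qed
  have "\<exists>F :: nat \<Rightarrow> 'a set. (\<forall>j. subtopology X (X frontier_of u i \<inter> F j) dim_le 0) \<and>
      X frontier_of u i \<subseteq> (\<Union>j. F j)" if "i \<in> I" for i
    using Pu[OF that] frontier_of_subset_topspace[of X "u i"] unfolding P_def subtopology_subtopology
    by (auto simp: Int_absorb1)
  then obtain F :: "'a set \<times> 'a set \<Rightarrow> nat \<Rightarrow> 'a set" where
    F: "\<And>i j. i \<in> I \<Longrightarrow> subtopology X (X frontier_of u i \<inter> F i j) dim_le 0"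
      "\<And>i. i \<in> I \<Longrightarrow> X frontier_of u i \<subseteq> (\<Union>j. F i j)"
    by metis
  define Z where "Z = topspace X - (\<Union>i\<in>I. X frontier_of u i)"
  have Z: "subtopology X Z dim_le 0"
    unfolding dim_le_0_iff_clopen_base
  proof clarify
    fix W x assume W: "openin (subtopology X Z) W" "x \<in> W"
    then obtain V where V: "openin X V" "W = V \<inter> Z"
      unfolding openin_subtopology by blast
    then obtain i where i: "i \<in> I" "x \<in> u i" "u i \<subseteq> V"
      using base W by blast
    have uo: "openin X (u i)"
      using Pu[OF i(1)] unfolding P_def by blast
    \<comment> \<open>Since \<open>Z\<close> misses the frontier of \<open>u i\<close>, the open set
      and its closure have the same trace on \<open>Z\<close>; this trace is therefore relatively
      clopen.\<close>
    have "Z \<inter> u i = Z \<inter> X closure_of u i"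
      using i(1) uo closure_of_subset[OF openin_subset[OF uo]]
      unfolding Z_def frontier_of_def by (auto simp: interior_of_openin)
    moreover have "closedin (subtopology X Z) (Z \<inter> X closure_of u i)"
      by (simp add: closedin_subtopology_Int_closed)
    moreover have "openin (subtopology X Z) (Z \<inter> u i)"
      using uo by (rule openin_subtopology_Int2)
    ultimately show "\<exists>U. (closedin (subtopology X Z) U \<and> openin (subtopology X Z) U) \<and> x \<in> U \<and> U \<subseteq> W"
      using i V W by (intro exI[of _ "Z \<inter> u i"]) auto
  qed
  define \<F> where "\<F> = insert Z (\<Union>i\<in>I. range (\<lambda>j. X frontier_of u i \<inter> F i j))"
  have "countable \<F>"
    unfolding \<F>_def using \<open>countable I\<close> by auto
  moreover have "\<F> \<noteq> {}" unfolding \<F>_def by blast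
  ultimately obtain G :: "nat \<Rightarrow> 'a set" where G: "range G = \<F>"
    using uncountable_def by metis
  have "subtopology X T dim_le 0" if "T \<in> \<F>" for T
    using that Z F(1) unfolding \<F>_def by auto
  moreover have "topspace X \<subseteq> \<Union>\<F>"
  proof
    fix x assume x: "x \<in> topspace X"
    show "x \<in> \<Union>\<F>"
    proof (cases "x \<in> Z")
      case False
      then obtain i where i: "i \<in> I" "x \<in> X frontier_of u i"
        using x unfolding Z_def by blast
      then obtain j where "x \<in> F i j"
        using F(2) by blast
      then show ?thesis
        using i unfolding \<F>_def by auto
    qed (auto simp: \<F>_def)
  qed
  ultimately show ?case
    using G by (metis rangeI)
qed

lemma dim_le_0_prod_topology:
  assumes "X dim_le 0" "Y dim_le 0"
  shows "prod_topology X Y dim_le 0"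
  unfolding dim_le_0_iff_clopen_base
proof clarify
  fix W x y assume W: "openin (prod_topology X Y) W" "(x, y) \<in> W"
  then obtain U V where UV: "openin X U" "openin Y V" "x \<in> U" "y \<in> V" "U \<times> V \<subseteq> W"
    unfolding openin_prod_topology_alt by meson
  obtain U' where "closedin X U'" "openin X U'" "x \<in> U'" "U' \<subseteq> U"
    by (rule dim_le_0E[OF assms(1) UV(1,3)])
  moreover obtain V' where "closedin Y V'" "openin Y V'" "y \<in> V'" "V' \<subseteq> V"
    by (rule dim_le_0E[OF assms(2) UV(2,4)])
  ultimately show "\<exists>U. (closedin (prod_topology X Y) U \<and> openin (prod_topology X Y) U) \<and> (x, y) \<in> U \<and> U \<subseteq> W"
    using UV by (intro exI[of _ "U' \<times> V'"]) (auto simp: openin_prod_Times_iff closedin_prod_Times_iff)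
qed

lemma dim_le_0_product_topology:
  assumes "\<And>i. i \<in> I \<Longrightarrow> X i dim_le 0"
  shows "product_topology X I dim_le 0"
  unfolding dim_le_0_iff_clopen_base
proof clarify
  fix W x assume W: "openin (product_topology X I) W" "x \<in> W"
  then obtain U where U: "finite {i \<in> I. U i \<noteq> topspace (X i)}" "\<And>i. i \<in> I \<Longrightarrow> openin (X i) (U i)"
      "x \<in> Pi\<^sub>E I U" "Pi\<^sub>E I U \<subseteq> W"
    unfolding openin_product_topology_alt by meson
  \<comment> \<open>Taking the whole factor wherever \<open>U i\<close> is the whole factor leaves
    only finitely many proper factors, so the resulting box is open.\<close>
  have "\<exists>V. closedin (X i) V \<and> openin (X i) V \<and> x i \<in> V \<and> V \<subseteq> U i \<and> (U i = topspace (X i) \<longrightarrow> V = topspace (X i))"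
    if i: "i \<in> I" for i
  proof (cases "U i = topspace (X i)")
    case True
    then show ?thesis
      using U(3) i by (auto intro!: exI[of _ "topspace (X i)"])
  next
    case False
    have "x i \<in> U i" using U(3) i by auto
    then show ?thesis
      using False dim_le_0E[OF assms[OF i] U(2)[OF i]] by metis
  qed
  then obtain V where V: "\<And>i. i \<in> I \<Longrightarrow> closedin (X i) (V i)" "\<And>i. i \<in> I \<Longrightarrow> openin (X i) (V i)"
     "\<And>i. i \<in> I \<Longrightarrow> x i \<in> V i" "\<And>i. i \<in> I \<Longrightarrow> V i \<subseteq> U i" "\<And>i. i \<in> I \<Longrightarrow> U i = topspace (X i) \<Longrightarrow> V i = topspace (X i)"
    by metis
  show "\<exists>U. (closedin (product_topology X I) U \<and> openin (product_topology X I) U) \<and> x \<in> U \<and> U \<subseteq> W"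
  proof (intro exI conjI)
    show "closedin (product_topology X I) (Pi\<^sub>E I V)"
      using V(1) by (simp add: closedin_product_topology)
    have "finite {i \<in> I. V i \<noteq> topspace (X i)}"
      by (rule finite_subset[OF _ U(1)]) (use V(5) in auto)
    then show "openin (product_topology X I) (Pi\<^sub>E I V)"
      using V(2) by (simp add: openin_PiE_gen)
    show "x \<in> Pi\<^sub>E I V"
      using U(3) V(3) by (auto simp: PiE_iff)
    show "Pi\<^sub>E I V \<subseteq> W"
      using U(4) V(4) PiE_mono by blast
  qed
qed

text \<open>An interval with endpoints in \<open>Q\<close> has the same trace on \<open>S\<close>
  whether it is taken open or closed, because \<open>S\<close> misses \<open>Q\<close>. These traces
  are clopen and arbitrarily small.\<close>

lemma dim_le_0_real_subset:
  fixes S Q :: "real set"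
  assumes dense: "\<And>a b. a < b \<Longrightarrow> \<exists>q\<in>Q. a < q \<and> q < b" and disj: "S \<inter> Q = {}"
  shows "top_of_set S dim_le 0"
  unfolding dim_le_0_iff_clopen_base
proof clarify
  fix W x assume W: "openin (top_of_set S) W" "x \<in> W"
  then obtain T where T: "open T" "W = S \<inter> T"
    using openin_open by blast
  then obtain e where e: "e > 0" "ball x e \<subseteq> T"
    using W(2) open_contains_ball by blast
  obtain a where a: "a \<in> Q" "x - e < a" "a < x"
    using dense[of "x - e" x] e by auto
  obtain b where b: "b \<in> Q" "x < b" "b < x + e"
    using dense[of x "x + e"] e by auto
  have "S \<inter> {a<..<b} = S \<inter> {a..b}"
    using a b disj by (auto simp: less_le)
  moreover have "openin (top_of_set S) (S \<inter> {a<..<b})" "closedin (top_of_set S) (S \<inter> {a..b})"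
    by (auto simp: openin_open_Int closedin_closed_Int)
  moreover have "{a<..<b} \<subseteq> ball x e"
    using a b by (auto simp: dist_real_def)
  ultimately show "\<exists>U. (closedin (top_of_set S) U \<and> openin (top_of_set S) U) \<and> x \<in> U \<and> U \<subseteq> W"
    using T W a b e by (intro exI[of _ "S \<inter> {a<..<b}"]) auto
qed

text \<open>The translates of the rationals by the multiples \<open>real i * t\<close> of an
  irrational \<open>t\<close> are dense. A common point of two of them would make \<open>t\<close>
  rational.\<close>

lemma disjoint_dense_sets_of_reals:
  obtains Q :: "nat \<Rightarrow> real set"
  where "disjoint_family Q" "\<And>i a b. a < b \<Longrightarrow> \<exists>q\<in>Q i. a < q \<and> q < b"
proof -
  obtain t :: real where t: "t \<notin> \<rat>"
    using countable_rat uncountable_UNIV_real by (metis UNIV_eq_I)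
  define Q where "Q i = {x. x - real i * t \<in> \<rat>}" for i :: nat
  have "Q i \<inter> Q j = {}" if "i \<noteq> j" for i j
  proof (rule ccontr)
    assume "Q i \<inter> Q j \<noteq> {}"
    then obtain x where "x - real i * t \<in> \<rat>" "x - real j * t \<in> \<rat>"
      unfolding Q_def by blast
    then have "(x - real i * t) - (x - real j * t) \<in> \<rat>"
      by (rule Rats_diff)
    then have "(real j - real i) * t \<in> \<rat>"
      by (simp add: algebra_simps)
    then have "((real j - real i) * t) / (real j - real i) \<in> \<rat>"
      by (intro Rats_divide) auto
    then show False
      using that t by simp
  qed
  moreover have "\<exists>q\<in>Q i. a < q \<and> q < b" if "a < b" for i a b
  proof -
    have "a - real i * t < b - real i * t"
      using that by simp
    then obtain q where "q \<in> \<rat>" "a - real i * t < q" "q < b - real i * t"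
      using Rats_dense_in_real by blast
    then show ?thesis
      unfolding Q_def by (intro bexI[of _ "q + real i * t"]) auto
  qed
  ultimately show thesis
    by (intro that[of Q]) (simp_all add: disjoint_family_on_def)
qed

lemma topspace_unit_cube: "topspace (unit_cube n) = {..<n} \<rightarrow>\<^sub>E {0..1}"
  by (simp add: unit_cube_def)

text \<open>The set \<open>D i\<close> consists of the points with no coordinate in the dense set
  \<open>Q i\<close>; its trace on the cube is a product of zero-dimensional sets of reals.\<close>

lemma unit_cube_zero_dimensional_decomposition:
  obtains D :: "nat \<Rightarrow> (nat \<Rightarrow> real) set"
  where "\<And>i. subtopology (unit_cube n) (D i) dim_le 0" "topspace (unit_cube n) \<subseteq> (\<Union>i\<le>n. D i)"
proof -
  obtain Q :: "nat \<Rightarrow> real set" where Q: "disjoint_family Q" "\<And>i a b. a < b \<Longrightarrow> \<exists>q\<in>Q i. a < q \<and> q < b"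
    using disjoint_dense_sets_of_reals by blast
  \<comment> \<open>Each of the \<open>n\<close> coordinates of a point lies in at most one \<open>Q i\<close>, so the point
    belongs to \<open>D i\<close> for one of the \<open>n + 1\<close> indices \<open>i \<le> n\<close>.\<close>
  define D where "D i = ({..<n} \<rightarrow>\<^sub>E - Q i)" for i
  have "subtopology (unit_cube n) (D i) dim_le 0" for i
    unfolding unit_cube_def D_def subtopology_product_topology subtopology_subtopology
    by (intro dim_le_0_product_topology dim_le_0_real_subset[OF Q(2)]) auto
  moreover have "x \<in> (\<Union>i\<le>n. D i)" if x: "x \<in> topspace (unit_cube n)" for x
  proof (rule ccontr)
    assume "x \<notin> (\<Union>i\<le>n. D i)"
    then have "\<exists>j<n. x j \<in> Q i" if "i \<le> n" for i
      using x that unfolding D_def topspace_unit_cube by (fastforce simp: PiE_iff)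
    then obtain f where f: "\<And>i. i \<le> n \<Longrightarrow> f i < n \<and> x (f i) \<in> Q i"
      by metis
    have "inj_on f {..n}"
      using f Q(1) unfolding inj_on_def disjoint_family_on_def by (metis UNIV_I atMost_iff disjoint_iff)
    then have "card {..n} \<le> card {..<n}"
      by (rule card_inj_on_le) (use f in auto)
    then show False by simp
  qed
  ultimately show thesis
    using that by blast
qed

section \<open>Well-orders and the length of the game\<close>

lemma Field_ord_plus: "Field (r +\<^sub>o s) = Inl ` Field r \<union> Inr ` Field s"
  unfolding ord_plus_def Field_def by (fastforce simp: image_iff)

lemma ord_plus_simps [simp]:
  "(Inl a, Inl b) \<in> r +\<^sub>o s \<longleftrightarrow> (a, b) \<in> r"
  "(Inr c, Inr d) \<in> r +\<^sub>o s \<longleftrightarrow> (c, d) \<in> s"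
  "(Inl a, Inr d) \<in> r +\<^sub>o s \<longleftrightarrow> a \<in> Field r \<and> d \<in> Field s"
  "(Inr c, Inl b) \<notin> r +\<^sub>o s"
  unfolding ord_plus_def by (auto simp: image_iff map_prod_def split: prod.splits)

lemma Well_order_ord_plus:
  assumes r: "Well_order r" and s: "Well_order s"
  shows "Well_order (r +\<^sub>o s)"
proof -
  have "Refl (r +\<^sub>o s)"
    using r s unfolding order_on_defs refl_on_def Field_ord_plus by auto
  moreover have "trans (r +\<^sub>o s)"
  proof (rule transI)
    fix x y z assume "(x, y) \<in> r +\<^sub>o s" "(y, z) \<in> r +\<^sub>o s"
    moreover have "trans r" "trans s"
      using r s by (auto simp: order_on_defs)
    ultimately show "(x, z) \<in> r +\<^sub>o s"
      by (cases x; cases y; cases z) (auto intro: FieldI1 FieldI2 dest: transD)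
  qed
  moreover have "antisym (r +\<^sub>o s)"
  proof (rule antisymI)
    fix x y assume "(x, y) \<in> r +\<^sub>o s" "(y, x) \<in> r +\<^sub>o s"
    moreover have "antisym r" "antisym s"
      using r s by (auto simp: order_on_defs)
    ultimately show "x = y"
      by (cases x; cases y) (auto dest: antisymD)
  qed
  moreover have "Total (r +\<^sub>o s)"
  proof -
    have "Total r" "Total s"
      using r s by (auto simp: order_on_defs)
    then show ?thesis
      unfolding total_on_def Field_ord_plus by force
  qed
  moreover have "wf (r +\<^sub>o s - Id)"
  proof (rule wfI_min)
    fix x :: "'a + 'b" and Q assume x: "x \<in> Q"
    have wf: "wf (r - Id)" "wf (s - Id)"
      using r s by (auto simp: well_order_on_def)
    show "\<exists>z\<in>Q. \<forall>y. (y, z) \<in> r +\<^sub>o s - Id \<longrightarrow> y \<notin> Q"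
    \<comment> \<open>The left summand lies below the right one, so a minimal element is sought on
      the left first, and on the right only if \<open>Q\<close> has no element on the left.\<close>
    proof (cases "\<exists>a. Inl a \<in> Q")
      case True
      then obtain a0 where "a0 \<in> {a. Inl a \<in> Q}"
        by blast
      then obtain a where a: "Inl a \<in> Q" "\<And>b. (b, a) \<in> r - Id \<Longrightarrow> Inl b \<notin> Q"
        using wfE_min[OF wf(1)] by (metis (no_types, lifting) mem_Collect_eq)
      show ?thesis
      proof (intro bexI[OF _ a(1)] allI impI)
        fix y assume "(y, Inl a) \<in> r +\<^sub>o s - Id"
        then show "y \<notin> Q"
          using a(2) by (cases y) auto
      qed
    next
      case False
      then obtain c0 where "c0 \<in> {c. Inr c \<in> Q}"
        using x by (cases x) auto
      then obtain c where c: "Inr c \<in> Q" "\<And>b. (b, c) \<in> s - Id \<Longrightarrow> Inr b \<notin> Q"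
        using wfE_min[OF wf(2)] by (metis (no_types, lifting) mem_Collect_eq)
      show ?thesis
      proof (intro bexI[OF _ c(1)] allI impI)
        fix y assume "(y, Inr c) \<in> r +\<^sub>o s - Id"
        then show "y \<notin> Q"
          using c(2) False by (cases y) auto
      qed
    qed
  qed
  ultimately show ?thesis
    unfolding order_on_defs by (auto simp: Field_def)
qed

text \<open>Otherwise \<open>p\<close> would be isomorphic to a proper initial segment of its own
  restriction, giving an injective order-preserving \<open>f\<close> with \<open>f a\<close>
  strictly below \<open>a\<close>. For the least such point \<open>b\<close>, the point
  \<open>f b\<close> is a smaller one, which is absurd. The lemma ensures that deleting the first
  inning does not lengthen the order.\<close>

lemma Restr_ordLeq:
  fixes p :: "'i rel"
  assumes p: "Well_order p"
  shows "Restr p A \<le>o p"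
proof (rule ccontr)
  let ?d = "Restr p A"
  assume "\<not> ?d \<le>o p"
  then have "p <o ?d"
    using p Well_order_Restr not_ordLeq_iff_ordLess by blast
  then obtain a where a: "a \<in> Field ?d" and iso: "p =o Restr ?d (underS ?d a)"
    using ordLess_iff_ordIso_Restr[OF Well_order_Restr[OF p] p] by blast
  then obtain f where f: "iso p (Restr ?d (underS ?d a)) f"
    unfolding ordIso_def by blast
  have f_Field: "f x \<in> underS ?d a" if "x \<in> Field p" for x
    using iso_Field[OF f] that Field_Restr_subset[of ?d "underS ?d a"] by blast
  have f_mono: "(f x, f y) \<in> p" if "(x, y) \<in> p" for x y
    using iso_forward[OF that f] by blast
  have f_inj: "inj_on f (Field p)"
    using f by (rule iso_imp_inj_on)
  have aF: "a \<in> Field p"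
    using a by (auto simp: Field_def)
  then have "(f a, a) \<in> p - Id"
    using f_Field unfolding underS_def by auto
  moreover have "wf (p - Id)"
    using p by (simp add: well_order_on_def)
  ultimately obtain b where b: "(f b, b) \<in> p - Id" "\<And>c. (c, b) \<in> p - Id \<Longrightarrow> (f c, c) \<notin> p - Id"
    using wfE_min[of "p - Id" a "{b. (f b, b) \<in> p - Id}"] by (metis (no_types, lifting) mem_Collect_eq)
  then have "b \<in> Field p" "f b \<in> Field p" "f b \<noteq> b"
    by (auto simp: Field_def)
  then have "f (f b) \<noteq> f b"
    using f_inj by (auto dest: inj_onD)
  then show False
    using b f_mono by auto
qed

section \<open>Transport of strategies and the least winning length\<close>

lemma two_has_winning_strategy_ordIso:
  fixes r :: "'i rel" and s :: "'j rel"
  assumes win: "two_has_winning_strategy X r" and "r =o s"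
  shows "two_has_winning_strategy X s"
proof -
  obtain f where f: "iso s r f"
    using ordIso_symmetric[OF assms(2)] unfolding ordIso_def by blast
  define g where "g = inv_into (Field s) f"
  have inj: "inj_on f (Field s)" and im: "f ` Field s = Field r"
    using f iso_imp_inj_on iso_Field by blast+
  have gf: "g (f \<gamma>) = \<gamma>" if "\<gamma> \<in> Field s" for \<gamma>
    using inj that unfolding g_def by simp
  obtain \<sigma> where \<sigma>: "\<And>A. \<forall>\<gamma>\<in>Field r. open_cover X (A \<gamma>) \<Longrightarrow>
      two_wins_play X r A (\<lambda>\<gamma>. \<sigma> \<gamma> (restrict A (under r \<gamma>)))"
    using win unfolding two_has_winning_strategy_def by blast
  \<comment> \<open>The moves of ONE are carried over to \<open>r\<close> by \<open>g\<close>, the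
    inverse of \<open>f\<close>, and answered there by \<open>\<sigma>\<close>.\<close>
  define \<tau> where "\<tau> \<gamma> A = \<sigma> (f \<gamma>) (restrict (A \<circ> g) (under r (f \<gamma>)))" for \<gamma> A
  show ?thesis
    unfolding two_has_winning_strategy_def
  proof (intro exI allI impI)
    fix A assume A: "\<forall>\<gamma>\<in>Field s. open_cover X (A \<gamma>)"
    have "g \<delta> \<in> Field s" if "\<delta> \<in> Field r" for \<delta>
      using that im unfolding g_def by (metis inv_into_into)
    then have win: "two_wins_play X r (A \<circ> g) (\<lambda>\<gamma>. \<sigma> \<gamma> (restrict (A \<circ> g) (under r \<gamma>)))"
      using A by (intro \<sigma>) auto
    have \<tau>: "\<tau> \<gamma> (restrict A (under s \<gamma>)) = \<sigma> (f \<gamma>) (restrict (A \<circ> g) (under r (f \<gamma>)))"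
      if \<gamma>: "\<gamma> \<in> Field s" for \<gamma>
    proof -
      \<comment> \<open>The innings up to \<open>f \<gamma>\<close> in \<open>r\<close> correspond
        to innings up to \<open>\<gamma>\<close> in \<open>s\<close>, so \<open>\<tau>\<close> uses
        only moves already made.\<close>
      have "g \<delta> \<in> under s \<gamma>" if "\<delta> \<in> under r (f \<gamma>)" for \<delta>
        using iso_backward[OF _ f, of \<delta> "f \<gamma>"] that gf[OF \<gamma>] unfolding under_def g_def by simp
      then have "restrict (restrict A (under s \<gamma>) \<circ> g) (under r (f \<gamma>)) = restrict (A \<circ> g) (under r (f \<gamma>))"
        by (intro ext) (simp add: restrict_def)
      then show ?thesis
        unfolding \<tau>_def by simp
    qed
    show "two_wins_play X s A (\<lambda>\<gamma>. \<tau> \<gamma> (restrict A (under s \<gamma>)))"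
      unfolding two_wins_play_def
    proof (intro conjI ballI)
      fix \<gamma> assume "\<gamma> \<in> Field s"
      then show "disjoint_refinement (\<tau> \<gamma> (restrict A (under s \<gamma>))) (A \<gamma>)"
        using win im gf \<tau> unfolding two_wins_play_def by force
    next
      have "(\<Union>\<gamma>\<in>Field s. \<tau> \<gamma> (restrict A (under s \<gamma>)))
          = (\<Union>\<delta>\<in>Field r. \<sigma> \<delta> (restrict (A \<circ> g) (under r \<delta>)))"
        unfolding im[symmetric] using \<tau> by simp
      then show "open_cover X (\<Union>\<gamma>\<in>Field s. \<tau> \<gamma> (restrict A (under s \<gamma>)))"
        using win unfolding two_wins_play_def by simp
    qed
  qed
qed

text \<open>With no innings TWO plays nothing and covers only the empty space. Hence a winning
  length has a first inning that can be split off as the summand 1.\<close>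

lemma two_has_winning_strategy_Field_nonempty:
  assumes "two_has_winning_strategy X r" "topspace X \<noteq> {}"
  shows "Field r \<noteq> {}"
proof
  assume "Field r = {}"
  then have "open_cover X {}"
    using assms(1) unfolding two_has_winning_strategy_def two_wins_play_def by auto
  then show False
    using assms(2) unfolding open_cover_def by auto
qed

text \<open>The isomorphism sends the added bottom element to the least element \<open>m\<close> and
  fixes the rest. It turns a nonzero winning length into the form \<open>1 + d\<close> that defines
  the game dimension.\<close>

lemma ordIso_one_plus_Restr_minus_least:
  fixes p :: "'i rel"
  assumes p: "Well_order p" and m: "m \<in> Field p" "\<And>x. x \<in> Field p \<Longrightarrow> (m, x) \<in> p"
  shows "natLeq_on 1 +\<^sub>o Restr p (Field p - {m}) =o p"
proof -
  let ?d = "Restr p (Field p - {m})"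
  let ?f = "case_sum (\<lambda>_. m) id"
  have refl: "Refl p" and anti: "antisym p"
    using p by (auto simp: order_on_defs)
  have Fd: "Field ?d = Field p - {m}"
    by (rule Refl_Field_Restr2[OF refl]) blast
  define e where "e = natLeq_on 1"
  have F1: "Field e = {0}" "(0, 0) \<in> e"
    unfolding e_def Field_natLeq_on by auto
  have F: "Field (e +\<^sub>o ?d) = insert (Inl 0) (Inr ` (Field p - {m}))"
    unfolding Field_ord_plus F1 Fd by simp
  have "iso (e +\<^sub>o ?d) p ?f"
    unfolding iso_iff2
  proof (intro conjI ballI)
    show "bij_betw ?f (Field (e +\<^sub>o ?d)) (Field p)"
      unfolding F bij_betw_def inj_on_def using m(1) by (auto simp: image_image)
    fix a b assume "a \<in> Field (e +\<^sub>o ?d)" "b \<in> Field (e +\<^sub>o ?d)"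
    then show "(a, b) \<in> e +\<^sub>o ?d \<longleftrightarrow> (?f a, ?f b) \<in> p"
      using m anti unfolding F by (auto simp: F1 Fd dest: antisymD)
  qed
  then show ?thesis
    unfolding ordIso_def e_def using p Well_order_ord_plus[OF natLeq_on_Well_order Well_order_Restr[OF p]] by blast
qed

lemma game_dim_le_if_two_has_winning_strategy:
  fixes r :: "'i rel"
  assumes r: "Well_order r" "two_has_winning_strategy X r" and X: "topspace X \<noteq> {}"
  shows "game_dim_le X r"
proof -
  \<comment> \<open>The game type of \<open>natLeq_on 1 +\<^sub>o d\<close> compares well-orders on
    the type \<open>nat + 'i\<close>, so the minimum is taken over that type, to which
    \<open>r\<close> is copied by \<open>Inr\<close>.\<close>
  let ?R = "{s :: (nat + 'i) rel. Well_order s \<and> two_has_winning_strategy X s}"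
  have copy: "r =o dir_image r Inr"
    by (rule dir_image_ordIso[OF r(1)]) simp
  then have "dir_image r Inr \<in> ?R"
    using r(2) two_has_winning_strategy_ordIso unfolding ordIso_def by blast
  then obtain s where s: "s \<in> ?R" "\<And>s'. s' \<in> ?R \<Longrightarrow> s \<le>o s'"
    using exists_minim_Well_order[of ?R] by blast
  have "s \<le>o r"
    using s(2)[OF \<open>dir_image r Inr \<in> ?R\<close>] ordIso_symmetric[OF copy] by (rule ordLeq_ordIso_trans)
  \<comment> \<open>Being at most \<open>r\<close>, the minimum has a representative on
    \<open>'i\<close>, the type on which \<open>d\<close> has to live.\<close>
  then obtain p :: "'i rel" where p: "s =o p" "p \<le>o r"
    unfolding internalize_ordLeq[of s] by blast
  then have wo: "Well_order p"
    unfolding ordIso_def by blast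
  have "two_has_winning_strategy X p"
    using s(1) p(1) two_has_winning_strategy_ordIso by blast
  then have ne: "Field p \<noteq> {}"
    using X by (rule two_has_winning_strategy_Field_nonempty)
  define m where "m = wo_rel.minim p (Field p)"
  have m: "m \<in> Field p" "\<And>x. x \<in> Field p \<Longrightarrow> (m, x) \<in> p"
    using wo ne unfolding m_def by (auto simp: wo_rel_def wo_rel.minim_in wo_rel.minim_least)
  define d where "d = Restr p (Field p - {m})"
  have d: "Well_order d" "d \<le>o r"
    unfolding d_def using wo p(2) Well_order_Restr Restr_ordLeq ordLeq_transitive by blast+
  have iso: "s =o natLeq_on 1 +\<^sub>o d"
    using p(1) ordIso_symmetric[OF ordIso_one_plus_Restr_minus_least[OF wo m]]
    unfolding d_def by (rule ordIso_transitive)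
  have "has_game_type X (natLeq_on 1 +\<^sub>o d)"
    unfolding has_game_type_def
  proof (intro conjI allI impI)
    show "Well_order (natLeq_on 1 +\<^sub>o d)"
      by (intro Well_order_ord_plus natLeq_on_Well_order d)
    show "two_has_winning_strategy X (natLeq_on 1 +\<^sub>o d)"
      using s(1) iso two_has_winning_strategy_ordIso by blast
    fix s' :: "(nat + 'i) rel" assume "Well_order s' \<and> two_has_winning_strategy X s'"
    then show "natLeq_on 1 +\<^sub>o d \<le>o s'"
      using s(2) ordIso_symmetric[OF iso] ordIso_ordLeq_trans by blast
  qed
  then show ?thesis
    unfolding game_dim_le_def has_game_dim_def using d by blast
qed

section \<open>The winning strategy\<close>

text \<open>TWO covers \<open>P k\<close> in inning \<open>k\<close>. After \<omega> innings the
  uncovered set is closed, disjoint from all \<open>P k\<close> and known to TWO, who decomposes it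
  by \<open>rest\<close> and covers its \<open>n + 1\<close> pieces one per inning.\<close>

lemma two_has_winning_strategy_omega_plus:
  fixes X :: "'a topology"
  assumes X: "metrizable_space X" "second_countable X"
    and P: "\<And>k. subtopology X (P k) dim_le 0"
    and rest: "\<And>C. closedin X C \<Longrightarrow> C \<inter> (\<Union>k::nat. P k) = {} \<Longrightarrow>
      \<exists>E. (\<forall>i. subtopology X (E i) dim_le 0) \<and> C \<subseteq> (\<Union>i\<le>n. E i)"
  shows "two_has_winning_strategy X (natLeq +\<^sub>o natLeq_on n +\<^sub>o natLeq_on 1)"
proof -
  let ?r = "natLeq +\<^sub>o natLeq_on n +\<^sub>o natLeq_on 1"
  define G where "G S \<A> = (SOME \<B>. disjoint_refinement \<B> \<A> \<and> (\<forall>B\<in>\<B>. openin X B) \<and> S \<inter> topspace X \<subseteq> \<Union>\<B>)"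
    for S \<A>
  have G: "disjoint_refinement (G S \<A>) \<A>" "\<And>B. B \<in> G S \<A> \<Longrightarrow> openin X B" "S \<inter> topspace X \<subseteq> \<Union>(G S \<A>)"
    if "open_cover X \<A>" "subtopology X S dim_le 0" for S \<A>
    using someI_ex[OF disjoint_open_refinement_of_zero_dimensional_subset[OF X that]]
    unfolding G_def by blast+
  \<comment> \<open>This set is what the first \<omega> innings leave uncovered; it depends on no
    later move.\<close>
  define C where "C A = topspace X - (\<Union>k. \<Union>(G (P k) (A (Inl (Inl k)))))"
    for A :: "(nat + nat) + nat \<Rightarrow> 'a set set"
  \<comment> \<open>The decomposition is a fixed function of \<open>C\<close>, so all the last
    innings work on the same one.\<close>
  define E where "E C = (SOME E. (\<forall>i. subtopology X (E i) dim_le 0) \<and> C \<subseteq> (\<Union>i\<le>n. E i))" for C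
  \<comment> \<open>The target set of each inning. The pieces with index below \<open>n\<close> fall
    to the summand \<open>natLeq_on n\<close>, the piece with index \<open>n\<close> to the final
    inning.\<close>
  define S where "S \<gamma> A = (case \<gamma> of Inl (Inl k) \<Rightarrow> P k | Inl (Inr i) \<Rightarrow> E (C A) i | Inr _ \<Rightarrow> E (C A) n)"
    for \<gamma> :: "(nat + nat) + nat" and A
  define \<sigma> where "\<sigma> \<gamma> A = G (S \<gamma> A) (A \<gamma>)" for \<gamma> A
  have F: "Field ?r = range (\<lambda>k. Inl (Inl k)) \<union> (\<lambda>i. Inl (Inr i)) ` {..<n} \<union> {Inr 0}"
    unfolding Field_ord_plus Field_natLeq_on Field_natLeq by (auto simp: image_Un image_image)
  have fin_Field: "Inl (Inr i) \<in> Field ?r" if "i < n" for i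
    unfolding F using that by blast
  have last_Field: "Inr 0 \<in> Field ?r"
    unfolding F by blast
  have \<sigma>_restrict: "\<sigma> \<gamma> (restrict A (under ?r \<gamma>)) = \<sigma> \<gamma> A" if \<gamma>: "\<gamma> \<in> Field ?r" for \<gamma> A
  proof -
    have "\<gamma> \<in> under ?r \<gamma>"
      using \<gamma> unfolding F under_def by (auto simp: natLeq_def Field_ord_plus Field_natLeq_on)
    \<comment> \<open>Each of the first \<omega> innings precedes every later one, so
      \<open>C A\<close> can be computed from the restricted history.\<close>
    moreover have "Inl (Inl k) \<in> under ?r \<gamma>" if "\<forall>j. \<gamma> \<noteq> Inl (Inl j)" for k
      using that \<gamma> unfolding F under_def
      by (auto simp: Field_natLeq Field_ord_plus Field_natLeq_on) (auto simp: Field_def)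
    then have "S \<gamma> (restrict A (under ?r \<gamma>)) = S \<gamma> A"
      unfolding S_def C_def by (auto split: sum.splits)
    ultimately show ?thesis
      unfolding \<sigma>_def by simp
  qed
  have "two_wins_play X ?r A (\<lambda>\<gamma>. \<sigma> \<gamma> (restrict A (under ?r \<gamma>)))"
    if A: "\<forall>\<gamma>\<in>Field ?r. open_cover X (A \<gamma>)" for A
  proof -
    have AP: "open_cover X (A (Inl (Inl k)))" for k
      using A unfolding F by blast
    have "openin X (\<Union>k. \<Union>(G (P k) (A (Inl (Inl k)))))"
      using G(2)[OF AP P] by (intro openin_Union) blast
    then have "closedin X (C A)"
      unfolding C_def by blast
    moreover have "P k \<inter> topspace X \<subseteq> \<Union>(G (P k) (A (Inl (Inl k))))" for k
      by (rule G(3)[OF AP P])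
    then have "C A \<inter> (\<Union>k. P k) = {}"
      unfolding C_def by blast
    ultimately have "(\<forall>i. subtopology X (E (C A) i) dim_le 0) \<and> C A \<subseteq> (\<Union>i\<le>n. E (C A) i)"
      unfolding E_def by (intro someI_ex[OF rest])
    then have E: "\<And>i. subtopology X (E (C A) i) dim_le 0" "C A \<subseteq> (\<Union>i\<le>n. E (C A) i)"
      by simp_all
    have S: "subtopology X (S \<gamma> A) dim_le 0" for \<gamma>
      using P E(1) unfolding S_def by (auto split: sum.splits)
    have \<sigma>: "disjoint_refinement (\<sigma> \<gamma> A) (A \<gamma>)" "\<And>B. B \<in> \<sigma> \<gamma> A \<Longrightarrow> openin X B"
        "S \<gamma> A \<inter> topspace X \<subseteq> \<Union>(\<sigma> \<gamma> A)" if "\<gamma> \<in> Field ?r" for \<gamma>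
      using G[OF _ S] A that unfolding \<sigma>_def by blast+
    have "x \<in> \<Union>(\<Union>\<gamma>\<in>Field ?r. \<sigma> \<gamma> A)" if x: "x \<in> topspace X" for x
    proof (cases "x \<in> C A")
      case True
      then obtain i where i: "i \<le> n" "x \<in> E (C A) i"
        using E(2) by blast
      define \<gamma> :: "(nat + nat) + nat" where "\<gamma> = (if i = n then Inr 0 else Inl (Inr i))"
      have "\<gamma> \<in> Field ?r" "x \<in> S \<gamma> A"
        using i fin_Field[of i] last_Field unfolding \<gamma>_def S_def by auto
      then show ?thesis
        using \<sigma>(3)[of \<gamma>] x by blast
    next
      case False
      then obtain k where "x \<in> \<Union>(\<sigma> (Inl (Inl k)) A)"
        using x unfolding C_def \<sigma>_def S_def by auto
      then show ?thesis
        unfolding F by blast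
    qed
    moreover have "\<Union>(\<Union>\<gamma>\<in>Field ?r. \<sigma> \<gamma> A) \<subseteq> topspace X"
      using \<sigma>(2) openin_subset by blast
    ultimately have "open_cover X (\<Union>\<gamma>\<in>Field ?r. \<sigma> \<gamma> A)"
      unfolding open_cover_def using \<sigma>(2) by blast
    then show ?thesis
      unfolding two_wins_play_def using \<sigma>(1) \<sigma>_restrict by simp
  qed
  then show ?thesis
    unfolding two_has_winning_strategy_def by blast
qed

text \<open>The empty space has no open cover with exactly two elements, so it is vacuously weakly
  infinite dimensional.\<close>

lemma strongly_infinite_dimensional_nonempty:
  assumes "strongly_infinite_dimensional X"
  shows "topspace X \<noteq> {}"
proof
  assume empty: "topspace X = {}"
  have "card \<U> \<noteq> 2" if "open_cover X \<U>" for \<U>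
  proof -
    have "\<U> \<subseteq> {{}}"
      using that empty unfolding open_cover_def by auto
    then have "card \<U> \<le> 1"
      using card_mono[of "{{}}" \<U>] by simp
    then show ?thesis by simp
  qed
  then have "weakly_infinite_dimensional X"
    unfolding weakly_infinite_dimensional_def by blast
  then show False
    using assms by blast
qed

section \<open>The product of Pol's compactum with the cube\<close>

theorem lemma30:
  fixes K :: "'a topology" and n :: nat
  assumes "pol_compactum K"
  shows "game_dim_le (prod_topology K (unit_cube n)) (natLeq +\<^sub>o natLeq_on n +\<^sub>o natLeq_on 1)"
proof -
  let ?X = "prod_topology K (unit_cube n)"
  have K: "compact_space K" "metrizable_space K"
    using assms unfolding pol_compactum_def by blast+
  have "\<exists>M L. M \<subseteq> topspace K \<and> totally_disconnected (subtopology K M) \<and>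
      strongly_infinite_dimensional (subtopology K M) \<and>
      topspace K - M = (\<Union>k\<in>{1::nat..}. L k) \<and>
      (\<forall>k\<ge>1. compactin K (L k) \<and> top_dim (subtopology K (L k)) < \<infinity>)"
    using assms unfolding pol_compactum_def
    by (elim conjE exE) (intro exI conjI; assumption)
  then obtain M L where M: "M \<subseteq> topspace K" "totally_disconnected (subtopology K M)"
      "strongly_infinite_dimensional (subtopology K M)"
    and L: "topspace K - M = (\<Union>k\<in>{1::nat..}. L k)"
      "\<And>k. k \<ge> 1 \<Longrightarrow> top_dim (subtopology K (L k)) < \<infinity>"
    by (elim exE conjE) (rule that; blast)
  obtain D where D: "\<And>i. subtopology (unit_cube n) (D i) dim_le 0"
      "topspace (unit_cube n) \<subseteq> (\<Union>i\<le>n. D i)"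
    using unit_cube_zero_dimensional_decomposition by blast
  have cube: "compact_space (unit_cube n)" "metrizable_space (unit_cube n)"
    unfolding unit_cube_def
    by (auto simp: compact_space_product_topology metrizable_space_product_topology
        compact_space_subtopology metrizable_space_subtopology metrizable_space_euclidean)
  have X: "metrizable_space ?X" "second_countable ?X"
    using K cube by (auto simp: metrizable_space_prod_topology compact_space_prod_topology
        intro!: compact_metrizable_second_countable)
  have sub: "subtopology ?X (S \<times> D i) dim_le 0" if "subtopology K S dim_le 0" for S i
    unfolding subtopology_Times using that D(1) by (rule dim_le_0_prod_topology)
  have "\<exists>F :: nat \<Rightarrow> 'a set. (\<forall>j. subtopology K (F j) dim_le 0) \<and> L k \<subseteq> (\<Union>j. F j)" if k: "k \<ge> 1" for k
  proof -
    obtain m where "subtopology K (L k) dim_le m"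
      using L(2)[OF k] unfolding top_dim_finite_iff by blast
    then obtain F :: "nat \<Rightarrow> 'a set" where F: "\<And>j. subtopology (subtopology K (L k)) (F j) dim_le 0"
        "topspace (subtopology K (L k)) \<subseteq> (\<Union>j. F j)"
      using dim_le_imp_countable_Union_zero_dimensional second_countable_subtopology
        compact_metrizable_second_countable[OF K] by metis
    have "L k \<subseteq> topspace K"
      using L(1) k by auto
    then show ?thesis
      using F by (intro exI[of _ "\<lambda>j. L k \<inter> F j"]) (auto simp: subtopology_subtopology)
  qed
  then obtain F :: "nat \<Rightarrow> nat \<Rightarrow> 'a set" where
    F: "\<And>k j. k \<ge> 1 \<Longrightarrow> subtopology K (F k j) dim_le 0" "\<And>k. k \<ge> 1 \<Longrightarrow> L k \<subseteq> (\<Union>j. F k j)"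
    by metis
  \<comment> \<open>All triples are listed in one sequence, so that each product gets its own inning
    below \<omega>. The shift \<open>Suc k\<close> is due to the sets \<open>L k\<close> being
    indexed from 1.\<close>
  define P where "P m = (case from_nat m of (k, j, i) \<Rightarrow> F (Suc k) j \<times> D i)" for m
  have P: "subtopology ?X (P m) dim_le 0" for m
    unfolding P_def using sub F(1) by (auto split: prod.splits)
  have P_cover: "(topspace K - M) \<times> topspace (unit_cube n) \<subseteq> (\<Union>m. P m)"
  proof clarify
    fix x y assume x: "x \<in> topspace K" "x \<notin> M" and y: "y \<in> topspace (unit_cube n)"
    obtain k where k: "k \<ge> 1" "x \<in> L k"
      using x L(1) by auto
    then obtain j where "x \<in> F k j"
      using F(2) by blast
    moreover obtain i where "y \<in> D i"
      using y D(2) by blast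
    ultimately have "(x, y) \<in> P (to_nat (k - 1, j, i))"
      using k by (simp add: P_def)
    then show "(x, y) \<in> (\<Union>m. P m)"
      by blast
  qed
  have rest: "\<exists>E. (\<forall>i. subtopology ?X (E i) dim_le 0) \<and> C \<subseteq> (\<Union>i\<le>n. E i)"
    if C: "closedin ?X C" "C \<inter> (\<Union>m. P m) = {}" for C
  proof -
    have CX: "C \<subseteq> topspace K \<times> topspace (unit_cube n)"
      using closedin_subset[OF C(1)] by simp
    \<comment> \<open>The sets \<open>P m\<close> cover every point whose first coordinate lies
      outside \<open>M\<close>, and \<open>C\<close> misses them all.\<close>
    then have ZM: "fst ` C \<subseteq> M"
      using C(2) P_cover by fastforce
    have "compactin ?X C"
      using C(1) K cube by (simp add: closedin_compact_space compact_space_prod_topology)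
    then have "compactin K (fst ` C)"
      using image_compactin continuous_map_fst by blast
    \<comment> \<open>Although \<open>M\<close> is strongly infinite dimensional, a compact subset
      inherits total disconnectedness from it and is therefore zero-dimensional.\<close>
    moreover have "totally_disconnected (subtopology K (fst ` C))"
      using M(2) ZM unfolding totally_disconnected_def connectedin_subtopology by blast
    ultimately have "subtopology K (fst ` C) dim_le 0"
      using K by (intro compact_totally_disconnected_dim_le_0)
        (auto simp: compact_space_subtopology Hausdorff_space_subtopology metrizable_imp_Hausdorff_space)
    moreover have "C \<subseteq> (\<Union>i\<le>n. fst ` C \<times> D i)"
    proof clarify
      fix x y assume xy: "(x, y) \<in> C"
      then obtain i where "i \<le> n" "y \<in> D i"
        using CX D(2) by blast
      then show "(x, y) \<in> (\<Union>i\<le>n. fst ` C \<times> D i)"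
        using image_eqI[of x fst "(x, y)" C] xy by auto
    qed
    ultimately show ?thesis
      using sub by (intro exI[of _ "\<lambda>i. fst ` C \<times> D i"]) blast
  qed
  have "two_has_winning_strategy ?X (natLeq +\<^sub>o natLeq_on n +\<^sub>o natLeq_on 1)"
    by (rule two_has_winning_strategy_omega_plus[OF X P rest])
  moreover have "Well_order (natLeq +\<^sub>o natLeq_on n +\<^sub>o natLeq_on 1)"
    by (intro Well_order_ord_plus natLeq_on_Well_order natLeq_Well_order)
  \<comment> \<open>The set \<open>M\<close> is nonempty by its strong infinite dimensionality, and
    the cube is nonempty even for \<open>n = 0\<close>, where it is a single point.\<close>
  moreover have "topspace ?X \<noteq> {}"
    using strongly_infinite_dimensional_nonempty[OF M(3)]
    by (auto simp: topspace_unit_cube PiE_eq_empty_iff)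
  ultimately show ?thesis
    using game_dim_le_if_two_has_winning_strategy by blast
qed

end
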